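(* Let $\mathbf{A}$, $\mathfrak{D}$ satisfy the Composition Condition, let $f_1,\ldots,f_k\in\mathbf{A}$ satisfy the Invertibility Condition, and let $K$ be the operator $K=\mathfrak{D}^k-\sum_{i=1}^k \mathfrak{D}^k(f_i)\circ P_i$, all as defined in the context. For $L\in\mathrm{alg}(\mathbf{A},\mathfrak{D})$, one has $L(f_i)=0$ for all $1\le i\le k$ if and only if there exists $Q\in\mathrm{alg}(\mathbf{A},\mathfrak{D})$ such that $L=Q\circ K$.
   Context: Let $\mathbf{k}$ be a unital commutative ring and $\mathbf{A}$ an associative unital (not necessarily commutative) algebra over $\mathbf{k}$. Let $\mathfrak{D}\in\mathrm{End}_{\mathbf{k}}(\mathbf{A})$ be a fixed $\mathbf{k}$-linear endomorphism of $\mathbf{A}$ (not assumed multiplicative). Each $x\in\mathbf{A}$ is identified with the left multiplication operator $y\mapsto xy$ in $\mathrm{End}_{\mathbf{k}}(\mathbf{A})$. Let $\mathrm{alg}(\mathbf{A},\mathfrak{D})$ be the subring of $\mathrm{End}_{\mathbf{k}}(\mathbf{A})$ generated by $\mathbf{A}$ (acting by left multiplication) and $\mathfrak{D}$; its multiplication $\circ$ is composition. $\mathfrak{D}^0$ denotes $1\in\mathbf{A}$ (the identity operator). Composition Condition (assumed): for each $f\in\mathbf{A}$ there exist $p_f,q_f\in\mathbf{A}$ such that $\mathfrak{D}\circ f=p_f\circ\mathfrak{D}+q_f$ as operators. Invertibility Condition (assumed): $k\ge 1$ is an integer and $f_1,\ldots,f_k\in\mathbf{A}$ are such that the $k\times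 k$ matrix $\Phi$ over $\mathbf{A}$ with entries $\Phi_{lj}=\mathfrak{D}^{l-1}(f_j)$ ($1\le l,j\le k$) is invertible, i.e. has a two-sided inverse $\Phi^{-1}$ with entries in $\mathbf{A}$, for the usual product $(\Omega\cdot\Gamma)_{ij}=\sum_l\Omega_{il}\Gamma_{lj}$. For $1\le i\le k$ define $P_i=\sum_{l=1}^k(\Phi^{-1})_{il}\circ\mathfrak{D}^{l-1}$. *)

theory Defs
  imports "HOL-Algebra.Generated_Rings" "Jordan_Normal_Form.Matrix"
begin

text \<open>
  The sorts below are those of \<open>comm_ring_1\<close> and \<open>ring_1\<close> without the axiom \<open>0 \<noteq> 1\<close>, so that
  zero rings are admitted. This is also why the module axioms are spelled out: the library locale
  \<open>module\<close> requires scalars of sort \<open>comm_ring_1\<close>.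
\<close>

locale unital_algebra =
  fixes scale :: "'k::{comm_ring,comm_monoid_mult} \<Rightarrow> 'a::{ring,monoid_mult} \<Rightarrow> 'a"
  assumes scale_right_distrib: "scale c (x + y) = scale c x + scale c y"
    and scale_left_distrib: "scale (c + d) x = scale c x + scale d x"
    and scale_scale: "scale c (scale d x) = scale (c * d) x"
    and scale_one: "scale 1 x = x"
    and scale_mult_left: "scale c (x * y) = scale c x * y"
    and scale_mult_right: "scale c (x * y) = x * scale c y"

definition End_ring ::
  "('k::{comm_ring,comm_monoid_mult} \<Rightarrow> 'a::{ring,monoid_mult} \<Rightarrow> 'a) \<Rightarrow> ('a \<Rightarrow> 'a) ring" where
  "End_ring scale =
    \<lparr>carrier = {T. (\<forall>x y. T (x + y) = T x + T y) \<and> (\<forall>c x. T (scale c x) = scale c (T x))},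
     monoid.mult = (\<circ>), one = id, zero = (\<lambda>_. 0), add = (\<lambda>S T x. S x + T x)\<rparr>"

definition lmult :: "'a::times \<Rightarrow> 'a \<Rightarrow> 'a" where
  "lmult x = (\<lambda>y. x * y)"

definition alg ::
  "('k::{comm_ring,comm_monoid_mult} \<Rightarrow> 'a::{ring,monoid_mult} \<Rightarrow> 'a) \<Rightarrow> ('a \<Rightarrow> 'a) \<Rightarrow> ('a \<Rightarrow> 'a) set" where
  "alg scale D = generate_ring (End_ring scale) (insert D (range lmult))"

definition composition_condition :: "('a::{ring,monoid_mult} \<Rightarrow> 'a) \<Rightarrow> bool" where
  "composition_condition D \<longleftrightarrow>
    (\<forall>f. \<exists>p q. D \<circ> lmult f = (\<lambda>y. (lmult p \<circ> D) y + lmult q y))"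

text \<open>
  Indices are shifted to start at \<open>0\<close>: the elements \<open>f\<^sub>1, \<dots>, f\<^sub>k\<close> are \<open>f 0, \<dots>, f (k - 1)\<close>,
  and row \<open>l\<close> of \<open>\<Phi>\<close> carries the power \<open>D ^^ l\<close>, which is \<open>id\<close> for \<open>l = 0\<close>.
\<close>

definition Phi_mat :: "('a \<Rightarrow> 'a) \<Rightarrow> nat \<Rightarrow> (nat \<Rightarrow> 'a) \<Rightarrow> 'a mat" where
  "Phi_mat D k f = mat k k (\<lambda>(l, j). (D ^^ l) (f j))"

text \<open>
  The library's \<open>inverts_mat\<close> is restricted to sort \<open>semiring_1\<close>, hence the following.
\<close>

definition is_inverse_mat :: "nat \<Rightarrow> 'a::{ring,monoid_mult} mat \<Rightarrow> 'a mat \<Rightarrow> bool" where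
  "is_inverse_mat k M N \<longleftrightarrow>
    M \<in> carrier_mat k k \<and> N \<in> carrier_mat k k \<and> M * N = 1\<^sub>m k \<and> N * M = 1\<^sub>m k"

text \<open>In \<open>P_op\<close> and \<open>K_op\<close>, \<open>\<Psi>\<close> stands for \<open>\<Phi>\<^sup>-\<^sup>1\<close>; operators are added pointwise.\<close>

definition P_op ::
  "('a::{ring,monoid_mult} \<Rightarrow> 'a) \<Rightarrow> nat \<Rightarrow> 'a mat \<Rightarrow> nat \<Rightarrow> 'a \<Rightarrow> 'a" where
  "P_op D k \<Psi> i = (\<lambda>y. \<Sum>l<k. (lmult (\<Psi> $$ (i, l)) \<circ> (D ^^ l)) y)"

definition K_op ::
  "('a::{ring,monoid_mult} \<Rightarrow> 'a) \<Rightarrow> nat \<Rightarrow> (nat \<Rightarrow> 'a) \<Rightarrow> 'a mat \<Rightarrow> 'a \<Rightarrow> 'a" where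
  "K_op D k f \<Psi> =
    (\<lambda>y. (D ^^ k) y - (\<Sum>i<k. (lmult ((D ^^ k) (f i)) \<circ> P_op D k \<Psi> i) y))"

context unital_algebra
begin

lemma scale_zero_right: "scale c 0 = 0"
  using scale_right_distrib[of c 0 0] by simp

lemma scale_minus_right: "scale c (- x) = - scale c x"
  using scale_right_distrib[of c x "- x"] by (simp add: scale_zero_right eq_neg_iff_add_eq_0 add.commute)

lemma ring_End_ring: "ring (End_ring scale)"
proof (rule ringI)
  show "abelian_group (End_ring scale)"
  proof (rule abelian_groupI)
    fix S assume S: "S \<in> carrier (End_ring scale)"
    show "\<exists>T\<in>carrier (End_ring scale). T \<oplus>\<^bsub>End_ring scale\<^esub> S = \<zero>\<^bsub>End_ring scale\<^esub>"
      by (rule bexI[of _ "\<lambda>x. - S x"]) (use S in \<open>auto simp: End_ring_def scale_minus_right\<close>)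
  qed (auto simp: End_ring_def scale_right_distrib scale_zero_right algebra_simps)
  show "monoid (End_ring scale)"
    by (rule monoidI) (auto simp: End_ring_def)
qed (auto simp: End_ring_def algebra_simps)

lemma lmult_in_End_ring: "lmult x \<in> carrier (End_ring scale)"
  by (auto simp: End_ring_def lmult_def distrib_left scale_mult_right)

end

end

theory Submission
  imports Defs
begin

text \<open>
  The operator \<open>K\<close> is monic of degree \<open>k\<close> in \<open>D\<close>, and the Composition Condition lets \<open>D\<close> be moved
  to the right of coefficients. This gives right division with remainder: every \<open>L\<close> in the algebra
  equals \<open>Q \<circ> K + R\<close> with \<open>R = \<Sum>l<k. r\<^sub>l D\<^sup>l\<close> (lemma \<open>alg_division\<close>). Since
  \<open>P\<^sub>i (f\<^sub>j) = \<delta>\<^sub>i\<^sub>j\<close>, the operator \<open>K\<close> kills every \<open>f\<^sub>j\<close>, so \<open>L\<close> and \<open>R\<close> take the same values there.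
  If those values vanish, then the row vector \<open>r\<close> satisfies \<open>r \<Phi> = 0\<close>, and invertibility of \<open>\<Phi>\<close>
  forces \<open>r = 0\<close>, that is \<open>L = Q \<circ> K\<close>. Conversely,
  \<open>Q (K (f\<^sub>j)) = Q 0 = 0\<close> because \<open>Q\<close> is additive.

  The division itself is an induction over the generation of the algebra: the operators of the form
  \<open>Q \<circ> K + R\<close> include the identity and are stable under composition on the left with the generators,
  hence with every \<open>L\<close> in the algebra, and \<open>L = L \<circ> id\<close>.
\<close>

section \<open>The algebra generated by left multiplications and one endomorphism\<close>

locale operator_algebra = unital_algebra scale
  for scale :: "'k::{comm_ring,comm_monoid_mult} \<Rightarrow> 'a::{ring,monoid_mult} \<Rightarrow> 'a" +
  fixes D :: "'a \<Rightarrow> 'a"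
  assumes D_End: "D \<in> carrier (End_ring scale)"
begin

lemma End_ring_simps:
  "\<one>\<^bsub>End_ring scale\<^esub> = id"
  "S \<oplus>\<^bsub>End_ring scale\<^esub> T = (\<lambda>y. S y + T y)"
  "S \<otimes>\<^bsub>End_ring scale\<^esub> T = S \<circ> T"
  by (simp_all add: End_ring_def)

lemma alg_carrier: "T \<in> alg scale D \<Longrightarrow> T \<in> carrier (End_ring scale)"
  unfolding alg_def
  by (rule ring.generate_ring_in_carrier[OF ring_End_ring]) (use D_End lmult_in_End_ring in auto)

lemma alg_additive: "T \<in> alg scale D \<Longrightarrow> T (x + y) = T x + T y"
  using alg_carrier by (auto simp: End_ring_def)

lemma D_additive: "D (x + y) = D x + D y"
  using D_End by (auto simp: End_ring_def)

lemma End_ring_a_inv: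
  assumes "T \<in> carrier (End_ring scale)"
  shows "\<ominus>\<^bsub>End_ring scale\<^esub> T = (\<lambda>y. - T y)"
proof -
  interpret E: ring "End_ring scale" by (rule ring_End_ring)
  show ?thesis
    by (rule E.minus_equality) (use assms in \<open>auto simp: End_ring_def scale_minus_right\<close>)
qed

lemma alg_D: "D \<in> alg scale D"
  unfolding alg_def by (rule generate_ring.incl) simp

lemma alg_lmult: "lmult a \<in> alg scale D"
  unfolding alg_def by (rule generate_ring.incl) simp

lemma alg_uminus: "T \<in> alg scale D \<Longrightarrow> (\<lambda>y. - T y) \<in> alg scale D"
  using generate_ring.a_inv[of T "End_ring scale"] End_ring_a_inv[of T] alg_carrier[of T]
  by (simp add: alg_def)

lemma alg_add: "S \<in> alg scale D \<Longrightarrow> T \<in> alg scale D \<Longrightarrow> (\<lambda>y. S y + T y) \<in> alg scale D"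
  unfolding alg_def using generate_ring.eng_add[of S "End_ring scale" _ T]
  by (simp only: End_ring_simps)

lemma alg_comp: "S \<in> alg scale D \<Longrightarrow> T \<in> alg scale D \<Longrightarrow> S \<circ> T \<in> alg scale D"
  unfolding alg_def using generate_ring.eng_mult[of S "End_ring scale" _ T]
  by (simp only: End_ring_simps)

lemma alg_zero: "(\<lambda>y. 0) \<in> alg scale D"
  using alg_lmult[of 0] by (simp add: lmult_def)

lemma alg_induct [consumes 1, case_names id D lmult uminus add comp]:
  assumes "T \<in> alg scale D"
    and id: "P id"
    and D: "P D"
    and lmult: "\<And>a. P (lmult a)"
    and uminus: "\<And>T. T \<in> alg scale D \<Longrightarrow> P T \<Longrightarrow> P (\<lambda>y. - T y)"
    and add: "\<And>S T. S \<in> alg scale D \<Longrightarrow> P S \<Longrightarrow> T \<in> alg scale D \<Longrightarrow> P T \<Longrightarrow> P (\<lambda>y. S y + T y)"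
    and comp: "\<And>S T. S \<in> alg scale D \<Longrightarrow> P S \<Longrightarrow> T \<in> alg scale D \<Longrightarrow> P T \<Longrightarrow> P (S \<circ> T)"
  shows "P T"
  using assms(1) unfolding alg_def
proof (induction rule: generate_ring.induct)
  case one
  then show ?case using id by (simp only: End_ring_simps)
next
  case (incl h)
  then show ?case using D lmult by auto
next
  case (a_inv h)
  then have h: "h \<in> alg scale D" by (simp add: alg_def)
  show ?case using uminus[OF h] a_inv by (simp add: End_ring_a_inv[OF alg_carrier[OF h]])
next
  case (eng_add S T)
  then show ?case using add[of S T] by (simp only: alg_def End_ring_simps)
next
  case (eng_mult S T)
  then show ?case using comp[of S T] by (simp only: alg_def End_ring_simps)
qed

end

section \<open>Right division by a monic operator\<close>

text \<open>
  Splits off the top term after multiplication by \<open>D\<close>; the coefficient at \<open>0\<close> is \<open>0\<close> because the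
  shifted sum has no term there.
\<close>

lemma sum_shift_split_top:
  fixes p h :: "nat \<Rightarrow> 'a::semiring_0"
  assumes "k \<ge> 1"
  shows "(\<Sum>l<k. p l * h (Suc l)) = (\<Sum>l<k. (if l = 0 then 0 else p (l - 1)) * h l) + p (k - 1) * h k"
proof -
  obtain m where k: "k = Suc m" using assms by (cases k) auto
  show ?thesis
    unfolding k by (subst (2) sum.lessThan_Suc_shift) simp
qed

context operator_algebra
begin

text \<open>
  Composing \<open>Q \<circ> K + R\<close> on the left with \<open>D\<close> raises the order of \<open>R\<close> by at most one, so only the
  power \<open>D\<^sup>k\<close> can leave the range of remainders. As \<open>K\<close> is monic, \<open>D\<^sup>k\<close> is \<open>K\<close> plus a remainder,
  and its coefficient moves into the quotient. This is why the operators of this shape are stable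
  under the algebra; taking \<open>id\<close>, which is a remainder because \<open>k \<ge> 1\<close>, gives the result for \<open>L\<close>.
\<close>

lemma alg_division:
  assumes cc: "composition_condition D" and k: "k \<ge> 1"
    and K: "\<And>y. K y = (D ^^ k) y - (\<Sum>l<k. b l * (D ^^ l) y)"
    and L: "L \<in> alg scale D"
  obtains Q r where "Q \<in> alg scale D" "\<And>y. L y = Q (K y) + (\<Sum>l<k. r l * (D ^^ l) y)"
proof -
  define quot_rem where "quot_rem T Q r \<longleftrightarrow>
    Q \<in> alg scale D \<and> (\<forall>y. T y = Q (K y) + (\<Sum>l<k. r l * (D ^^ l) y))" for T Q r
  define \<S> where "\<S> = {T. \<exists>Q r. quot_rem T Q r}"
  have \<S>I: "T \<in> \<S>" if "Q \<in> alg scale D" "\<And>y. T y = Q (K y) + (\<Sum>l<k. r l * (D ^^ l) y)" for T Q r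
  proof -
    have "quot_rem T Q r" using that by (simp add: quot_rem_def)
    then show ?thesis unfolding \<S>_def by blast
  qed
  have \<S>_add: "(\<lambda>y. S y + T y) \<in> \<S>" if ST: "S \<in> \<S>" "T \<in> \<S>" for S T
  proof -
    obtain Q r where 1: "quot_rem S Q r"
      using ST(1) unfolding \<S>_def by blast
    obtain Q' r' where 2: "quot_rem T Q' r'"
      using ST(2) unfolding \<S>_def by blast
    from 1 2 show ?thesis
      unfolding quot_rem_def
      by (intro \<S>I[OF alg_add, of Q Q' _ "\<lambda>l. r l + r' l"])
        (auto simp: distrib_right sum.distrib ac_simps)
  qed
  have \<S>_uminus: "(\<lambda>y. - T y) \<in> \<S>" if T: "T \<in> \<S>" for T
  proof -
    obtain Q r where "quot_rem T Q r"
      using T unfolding \<S>_def by blast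
    then show ?thesis
      unfolding quot_rem_def
      by (intro \<S>I[OF alg_uminus, of Q _ "\<lambda>l. - r l"]) (auto simp: sum_negf)
  qed
  have \<S>_lmult: "lmult a \<circ> T \<in> \<S>" if T: "T \<in> \<S>" for a T
  proof -
    obtain Q r where "quot_rem T Q r"
      using T unfolding \<S>_def by blast
    then show ?thesis
      unfolding quot_rem_def
      by (intro \<S>I[OF alg_comp[OF alg_lmult], of Q _ a "\<lambda>l. a * r l"])
        (auto simp: lmult_def distrib_left sum_distrib_left mult.assoc)
  qed
  have \<S>_D: "D \<circ> T \<in> \<S>" if T: "T \<in> \<S>" for T
  proof -
    obtain Q r where "quot_rem T Q r"
      using T unfolding \<S>_def by blast
    then have Q: "Q \<in> alg scale D" and T: "\<And>y. T y = Q (K y) + (\<Sum>l<k. r l * (D ^^ l) y)"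
      by (simp_all add: quot_rem_def)
    obtain p q where pq: "\<And>g. D \<circ> lmult g = (\<lambda>y. (lmult (p g) \<circ> D) y + lmult (q g) y)"
      using cc unfolding composition_condition_def by metis
    have D_mult: "D (g * y) = p g * D y + q g * y" for g y
      using fun_cong[OF pq[of g], of y] by (simp add: lmult_def)
    have D_zero: "D 0 = 0" using D_additive[of 0 0] by simp
    have D_sum: "D (sum h A) = (\<Sum>l\<in>A. D (h l))" for h and A :: "nat set"
      by (rule sum_comp_morphism[OF D_zero D_additive, unfolded comp_def, symmetric])
    \<comment> \<open>\<open>c\<close> is the coefficient of the overflowing power \<open>D\<^sup>k = K + \<Sum>l<k. b\<^sub>l D\<^sup>l\<close>: it joins the
      quotient, and the terms \<open>c b\<^sub>l\<close> return to the remainder.\<close>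
    define c where "c = p (r (k - 1))"
    define s where "s l = (if l = 0 then 0 else p (r (l - 1))) + q (r l) + c * b l" for l
    have "(D \<circ> T) y = (\<lambda>z. (D \<circ> Q) z + lmult c z) (K y) + (\<Sum>l<k. s l * (D ^^ l) y)" for y
    proof -
      have "(D \<circ> T) y = D (Q (K y)) + (\<Sum>l<k. p (r l) * (D ^^ Suc l) y) + (\<Sum>l<k. q (r l) * (D ^^ l) y)"
        by (simp add: T D_additive D_sum D_mult sum.distrib add.assoc)
      also have "(\<Sum>l<k. p (r l) * (D ^^ Suc l) y) =
          (\<Sum>l<k. (if l = 0 then 0 else p (r (l - 1))) * (D ^^ l) y) + c * (D ^^ k) y"
        unfolding c_def by (rule sum_shift_split_top[OF k])
      also have "(D ^^ k) y = K y + (\<Sum>l<k. b l * (D ^^ l) y)"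
        by (simp add: K)
      finally show ?thesis
        by (simp add: s_def lmult_def distrib_left distrib_right sum.distrib sum_distrib_left
            mult.assoc ac_simps)
    qed
    then show ?thesis
      by (intro \<S>I[OF alg_add[OF alg_comp[OF alg_D Q] alg_lmult]])
  qed
  have \<S>_id: "id \<in> \<S>"
    by (rule \<S>I[OF alg_zero, of _ "\<lambda>l. if l = 0 then 1 else 0"])
      (use k in \<open>simp add: if_distribR sum.delta if_distrib cong: if_cong\<close>)
  have "\<forall>T\<in>\<S>. L \<circ> T \<in> \<S>"
    using L
  proof (induction rule: alg_induct)
    case id
    then show ?case by simp
  next
    case D
    then show ?case using \<S>_D by blast
  next
    case (lmult a)
    then show ?case using \<S>_lmult by blast
  next
    case (uminus T)
    then show ?case using \<S>_uminus[of "T \<circ> _"] by (simp add: comp_def)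
  next
    case (add S T)
    then show ?case using \<S>_add[of "S \<circ> _" "T \<circ> _"] by (simp add: comp_def)
  next
    case (comp S T)
    then show ?case by (simp add: comp_assoc)
  qed
  then have "L \<in> \<S>" using \<S>_id by (metis comp_id)
  then obtain Q r where "quot_rem L Q r" unfolding \<S>_def by blast
  then show ?thesis by (intro that[of Q r]) (simp_all add: quot_rem_def)
qed

end

section \<open>The operator \<open>K\<close>\<close>

text \<open>
  Exhibits \<open>K\<close> as monic of degree \<open>k\<close> in \<open>D\<close>, the form needed for the division.
\<close>

lemma K_op_expand:
  "K_op D k f \<Psi> y =
    (D ^^ k) y - (\<Sum>l<k. (\<Sum>i<k. (D ^^ k) (f i) * \<Psi> $$ (i, l)) * (D ^^ l) y)"
proof -
  have "(\<Sum>i<k. (lmult ((D ^^ k) (f i)) \<circ> P_op D k \<Psi> i) y) =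
      (\<Sum>i<k. \<Sum>l<k. (D ^^ k) (f i) * \<Psi> $$ (i, l) * (D ^^ l) y)"
    by (simp add: P_op_def lmult_def sum_distrib_left mult.assoc)
  also have "\<dots> = (\<Sum>l<k. (\<Sum>i<k. (D ^^ k) (f i) * \<Psi> $$ (i, l)) * (D ^^ l) y)"
    by (subst sum.swap) (simp add: sum_distrib_right)
  finally show ?thesis by (simp add: K_op_def)
qed

lemma mat_mult_entry:
  assumes "M \<in> carrier_mat k k" "N \<in> carrier_mat k k" "i < k" "j < k"
  shows "(M * N) $$ (i, j) = (\<Sum>l<k. M $$ (i, l) * N $$ (l, j))"
  using assms by (auto simp: scalar_prod_def lessThan_atLeast0)

lemma P_op_dual:
  assumes "is_inverse_mat k (Phi_mat D k f) \<Psi>" "i < k" "j < k"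
  shows "P_op D k \<Psi> i (f j) = (if i = j then 1 else 0)"
proof -
  have "P_op D k \<Psi> i (f j) = (\<Sum>l<k. \<Psi> $$ (i, l) * Phi_mat D k f $$ (l, j))"
    using assms(3) by (simp add: P_op_def lmult_def Phi_mat_def)
  also have "\<dots> = (\<Psi> * Phi_mat D k f) $$ (i, j)"
    using assms by (subst mat_mult_entry) (auto simp: is_inverse_mat_def)
  also have "\<dots> = (if i = j then 1 else 0)"
    using assms by (simp add: is_inverse_mat_def)
  finally show ?thesis .
qed

lemma K_op_kills:
  assumes "is_inverse_mat k (Phi_mat D k f) \<Psi>" "j < k"
  shows "K_op D k f \<Psi> (f j) = 0"
proof -
  have "(\<Sum>i<k. (lmult ((D ^^ k) (f i)) \<circ> P_op D k \<Psi> i) (f j)) =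
      (\<Sum>i<k. if i = j then (D ^^ k) (f i) else 0)"
    by (rule sum.cong) (use assms in \<open>simp_all add: lmult_def P_op_dual\<close>)
  then show ?thesis using assms(2) by (simp add: K_op_def)
qed

text \<open>
  An operator of order less than \<open>k\<close> is determined by its values at the \<open>f\<^sub>j\<close>: these values form the
  row vector \<open>r \<Phi>\<close>, from which \<open>r\<close> is recovered by multiplying with \<open>\<Phi>\<^sup>-\<^sup>1\<close> on the right.
\<close>

lemma low_order_kernel_trivial:
  fixes r :: "nat \<Rightarrow> 'a::{ring,monoid_mult}"
  assumes inv: "is_inverse_mat k (Phi_mat D k f) \<Psi>"
    and zero: "\<And>j. j < k \<Longrightarrow> (\<Sum>l<k. r l * (D ^^ l) (f j)) = 0"
    and m: "m < k"
  shows "r m = 0"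
proof -
  have "(\<Sum>j<k. (D ^^ l) (f j) * \<Psi> $$ (j, m)) = (if l = m then 1 else 0)" if "l < k" for l
  proof -
    have "(\<Sum>j<k. (D ^^ l) (f j) * \<Psi> $$ (j, m)) = (Phi_mat D k f * \<Psi>) $$ (l, m)"
      using inv m that by (subst mat_mult_entry) (auto simp: is_inverse_mat_def Phi_mat_def)
    then show ?thesis using inv m that by (simp add: is_inverse_mat_def)
  qed
  then have "(\<Sum>l<k. r l * (\<Sum>j<k. (D ^^ l) (f j) * \<Psi> $$ (j, m))) = (\<Sum>l<k. if l = m then r l else 0)"
    by (intro sum.cong) auto
  also have "\<dots> = r m" using m by simp
  finally have "r m = (\<Sum>l<k. \<Sum>j<k. r l * (D ^^ l) (f j) * \<Psi> $$ (j, m))"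
    by (simp add: sum_distrib_left mult.assoc)
  also have "\<dots> = (\<Sum>j<k. (\<Sum>l<k. r l * (D ^^ l) (f j)) * \<Psi> $$ (j, m))"
    by (subst sum.swap) (simp add: sum_distrib_right)
  finally show ?thesis by (simp add: zero)
qed

theorem theorem1:
  fixes scale :: "'k::{comm_ring,comm_monoid_mult} \<Rightarrow> 'a::{ring,monoid_mult} \<Rightarrow> 'a"
    and D L :: "'a \<Rightarrow> 'a"
    and k :: nat
    and f :: "nat \<Rightarrow> 'a"
    and \<Psi> :: "'a mat"
  assumes "unital_algebra scale"
    and "D \<in> carrier (End_ring scale)"
    and "composition_condition D"
    and "k \<ge> 1"
    and "is_inverse_mat k (Phi_mat D k f) \<Psi>"
    and "L \<in> alg scale D"
  shows "(\<forall>i<k. L (f i) = 0) \<longleftrightarrow> (\<exists>Q\<in>alg scale D. L = Q \<circ> K_op D k f \<Psi>)"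
proof -
  interpret operator_algebra scale D
    using assms(1,2) by (simp add: operator_algebra_def operator_algebra_axioms_def)
  have alg_0: "Q 0 = 0" if "Q \<in> alg scale D" for Q
    using alg_additive[OF that, of 0 0] by simp
  show ?thesis
  proof
    assume L0: "\<forall>i<k. L (f i) = 0"
    obtain Q r where Q: "Q \<in> alg scale D"
      and L: "\<And>y. L y = Q (K_op D k f \<Psi> y) + (\<Sum>l<k. r l * (D ^^ l) y)"
      using alg_division[OF assms(3,4) K_op_expand assms(6)] by blast
    have "(\<Sum>l<k. r l * (D ^^ l) (f j)) = 0" if "j < k" for j
      using L[of "f j"] L0 that by (simp add: K_op_kills[OF assms(5)] alg_0[OF Q])
    then have "r l = 0" if "l < k" for l
      using low_order_kernel_trivial[OF assms(5)] that by blast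
    then have "L = Q \<circ> K_op D k f \<Psi>"
      by (auto simp: L)
    with Q show "\<exists>Q\<in>alg scale D. L = Q \<circ> K_op D k f \<Psi>" by blast
  next
    assume "\<exists>Q\<in>alg scale D. L = Q \<circ> K_op D k f \<Psi>"
    then show "\<forall>i<k. L (f i) = 0"
      by (auto simp: K_op_kills[OF assms(5)] alg_0)
  qed
qed

end
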